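(* For each $N$, let $(X^{(N)}_n)_{n\ge 0}$ be an aperiodic, irreducible, discrete-time Markov chain on a finite set $\mathbb{X}^{(N)}$ with stationary distribution $\pi^{(N)}$, and let $A^{(N)}\subset\mathbb{X}^{(N)}$ be a halting set for the total variation distance and this chain, such that $\sigma(T_{A^{(N)}})=o(\mathbb{E}[T_{A^{(N)}}])$ as $N\to\infty$. Let $\lambda_{A^{(N)}}$ be the largest eigenvalue of the restriction of the transition kernel of the chain to $\mathbb{X}^{(N)}\setminus A^{(N)}$. (1) If $(1-\lambda_{A^{(N)}})\,\mathbb{E}[T_{A^{(N)}}]\to+\infty$ as $N\to\infty$, then the family of chains has a cutoff at time $\mathbb{E}[T_{A^{(N)}}]$ for total variation. (2) If furthermore $\liminf_{N\to\infty}(1-\lambda_{A^{(N)}})\,\sigma(T_{A^{(N)}})>0$, then the family of chains has a cutoff at time $\mathbb{E}[T_{A^{(N)}}]$ with window $\sigma(T_{A^{(N)}})$ for total variation.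
   Context: Each chain is started from some given initial distribution. $d^{(N)}(n)$ is the total variation distance between the law of $X^{(N)}_n$ and $\pi^{(N)}$, where $\|\mu-\nu\|_{TV}=\sup_{B}|\mu(B)-\nu(B)|=\frac12\sum_x|\mu(x)-\nu(x)|$. $T_A$ is the hitting time of the set $A$ by the chain; $\mathbb{E}[T_A]$ and $\sigma(T_A)$ are its mean and standard deviation. $A^{(N)}$ is a halting set for the total variation distance and the chain if $d^{(N)}(n)\le\mathbb{P}(T_{A^{(N)}}>n)$ for all $n\ge 0$. The restriction of a kernel $K$ to a set $B$ is the matrix $(K(x,y))_{x,y\in B}$. $[\cdot]$ is the integer part. Cutoff at $t_N$: as $N\to\infty$, $d^{(N)}([ct_N])\to 0$ for every fixed $c>1$, and $d^{(N)}([ct_N])\to 1$ for every fixed $0<c<1$. Cutoff at $t_N$ with window $w_N$ (where $w_N=o(t_N)$): $\lim_{\gamma\to+\infty}\liminf_{N\to+\infty}d^{(N)}([t_N-\gamma w_N])=1$ and $\lim_{\gamma\to+\infty}\limsup_{N\to+\infty}d^{(N)}([t_N+\gamma w_N])=0$. *)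

theory Defs
  imports
    "HOL-Probability.Probability"
    "HOL-Library.Landau_Symbols"
    "Jordan_Normal_Form.Spectral_Radius"
begin

definition n_step :: "('a \<Rightarrow> 'a pmf) \<Rightarrow> nat \<Rightarrow> 'a \<Rightarrow> 'a pmf" where
  "n_step K n x = ((\<lambda>\<mu>. bind_pmf \<mu> K) ^^ n) (return_pmf x)"

definition kernel_on :: "'a set \<Rightarrow> ('a \<Rightarrow> 'a pmf) \<Rightarrow> bool" where
  "kernel_on S K \<longleftrightarrow> (\<forall>x\<in>S. set_pmf (K x) \<subseteq> S)"

definition irreducible_on :: "'a set \<Rightarrow> ('a \<Rightarrow> 'a pmf) \<Rightarrow> bool" where
  "irreducible_on S K \<longleftrightarrow> (\<forall>x\<in>S. \<forall>y\<in>S. \<exists>n. pmf (n_step K n x) y > 0)"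

definition aperiodic_on :: "'a set \<Rightarrow> ('a \<Rightarrow> 'a pmf) \<Rightarrow> bool" where
  "aperiodic_on S K \<longleftrightarrow> (\<forall>x\<in>S. Gcd {n. n > 0 \<and> pmf (n_step K n x) x > 0} = 1)"

definition stationary_on :: "'a set \<Rightarrow> ('a \<Rightarrow> 'a pmf) \<Rightarrow> 'a pmf \<Rightarrow> bool" where
  "stationary_on S K p \<longleftrightarrow> set_pmf p \<subseteq> S \<and> bind_pmf p K = p"

(* The law of the initial state X 0 is unconstrained. *)
definition markov_chain ::
  "'w measure \<Rightarrow> 'a set \<Rightarrow> ('a \<Rightarrow> 'a pmf) \<Rightarrow> (nat \<Rightarrow> 'w \<Rightarrow> 'a) \<Rightarrow> bool" where
  "markov_chain M S K X \<longleftrightarrow>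
     prob_space M \<and> kernel_on S K \<and>
     (\<forall>n. X n \<in> measurable M (count_space S)) \<and>
     (\<forall>n x. measure M {\<omega> \<in> space M. \<forall>i\<le>n. X i \<omega> = x i} > 0 \<longrightarrow>
        cond_prob M (\<lambda>\<omega>. X (Suc n) \<omega> = x (Suc n)) (\<lambda>\<omega>. \<forall>i\<le>n. X i \<omega> = x i)
          = pmf (K (x n)) (x (Suc n)))"

definition tv_dist :: "'a measure \<Rightarrow> 'a measure \<Rightarrow> real" where
  "tv_dist \<mu> \<nu> = (SUP B\<in>sets \<mu>. \<bar>measure \<mu> B - measure \<nu> B\<bar>)"

definition tv_to :: "'w measure \<Rightarrow> (nat \<Rightarrow> 'w \<Rightarrow> 'a) \<Rightarrow> 'a pmf \<Rightarrow> nat \<Rightarrow> real" where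
  "tv_to M X p n = tv_dist (distr M (count_space UNIV) (X n)) (measure_pmf p)"

definition hitting_time :: "(nat \<Rightarrow> 'w \<Rightarrow> 'a) \<Rightarrow> 'a set \<Rightarrow> 'w \<Rightarrow> enat" where
  "hitting_time X A \<omega> = (INF n\<in>{n. X n \<omega> \<in> A}. enat n)"

(* real_of_ereal sends infinity to 0. This is harmless for an irreducible chain on a finite
   set and a nonempty A: the hitting time is then almost surely finite, with finite moments. *)
definition real_hitting_time :: "(nat \<Rightarrow> 'w \<Rightarrow> 'a) \<Rightarrow> 'a set \<Rightarrow> 'w \<Rightarrow> real" where
  "real_hitting_time X A \<omega> = real_of_ereal (ereal_of_enat (hitting_time X A \<omega>))"

definition mean_hit :: "'w measure \<Rightarrow> (nat \<Rightarrow> 'w \<Rightarrow> 'a) \<Rightarrow> 'a set \<Rightarrow> real" where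
  "mean_hit M X A = prob_space.expectation M (real_hitting_time X A)"

definition sd_hit :: "'w measure \<Rightarrow> (nat \<Rightarrow> 'w \<Rightarrow> 'a) \<Rightarrow> 'a set \<Rightarrow> real" where
  "sd_hit M X A = sqrt (prob_space.variance M (real_hitting_time X A))"

definition tv_halting_set ::
  "'w measure \<Rightarrow> (nat \<Rightarrow> 'w \<Rightarrow> 'a) \<Rightarrow> 'a pmf \<Rightarrow> 'a set \<Rightarrow> bool" where
  "tv_halting_set M X p A \<longleftrightarrow>
     (\<forall>n. tv_to M X p n \<le> measure M {\<omega> \<in> space M. hitting_time X A \<omega> > enat n})"

(* The rows and columns are indexed through an enumeration of B. By eigenvalue_restrict_kernel
   below, the eigenvalues do not depend on it. *)
definition restrict_kernel :: "('a \<Rightarrow> 'a pmf) \<Rightarrow> 'a set \<Rightarrow> real mat" where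
  "restrict_kernel K B =
     mat (card B) (card B) (\<lambda>(i, j). pmf (K (from_nat_into B i)) (from_nat_into B j))"

(* The matrix is nonnegative, so for nonempty B the Perron-Frobenius theorem provides a real
   eigenvalue that dominates the modulus of every complex one; hence the real spectrum.
   For B = {} the spectrum is empty and the value is unspecified. *)
definition largest_eigenvalue :: "('a \<Rightarrow> 'a pmf) \<Rightarrow> 'a set \<Rightarrow> real" where
  "largest_eigenvalue K B = Max (spectrum (restrict_kernel K B))"

definition cutoff :: "(nat \<Rightarrow> nat \<Rightarrow> real) \<Rightarrow> (nat \<Rightarrow> real) \<Rightarrow> bool" where
  "cutoff d t \<longleftrightarrow>
     (\<forall>c>1. (\<lambda>N. d N (nat \<lfloor>c * t N\<rfloor>)) \<longlonglongrightarrow> 0) \<and>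
     (\<forall>c. 0 < c \<and> c < 1 \<longrightarrow> (\<lambda>N. d N (nat \<lfloor>c * t N\<rfloor>)) \<longlonglongrightarrow> 1)"

(* nat truncates negative times to 0. Since w = o(t) and t is nonnegative in the intended use,
   t N - \<gamma> * w N is nonnegative for each fixed \<gamma> and all large N. *)
definition cutoff_window ::
  "(nat \<Rightarrow> nat \<Rightarrow> real) \<Rightarrow> (nat \<Rightarrow> real) \<Rightarrow> (nat \<Rightarrow> real) \<Rightarrow> bool" where
  "cutoff_window d t w \<longleftrightarrow>
     w \<in> o(t) \<and>
     ((\<lambda>\<gamma>::real. liminf (\<lambda>N. ereal (d N (nat \<lfloor>t N - \<gamma> * w N\<rfloor>)))) \<longlongrightarrow> 1) at_top \<and>
     ((\<lambda>\<gamma>::real. limsup (\<lambda>N. ereal (d N (nat \<lfloor>t N + \<gamma> * w N\<rfloor>)))) \<longlongrightarrow> 0) at_top"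

lemma eigenvalue_restrict_kernel:
  assumes "finite B"
  shows "eigenvalue (restrict_kernel K B) r \<longleftrightarrow>
    (\<exists>v. (\<exists>x\<in>B. v x \<noteq> 0) \<and> (\<forall>x\<in>B. (\<Sum>y\<in>B. pmf (K x) y * v y) = r * v x))"
proof -
  define e where "e = from_nat_into B"
  define m where "m = card B"
  have e: "bij_betw e {0..<m} B"
    using bij_betw_from_nat_into_finite[OF assms] by (simp add: e_def m_def atLeast0LessThan)
  have eB: "e i \<in> B" if "i < m" for i
    using e that by (auto dest: bij_betwE)
  have R: "restrict_kernel K B = mat m m (\<lambda>(i, j). pmf (K (e i)) (e j))"
    by (simp add: restrict_kernel_def e_def m_def)
  have reindex: "(\<Sum>y\<in>B. g y) = (\<Sum>j\<in>{0..<m}. g (e j))" for g :: "'a \<Rightarrow> real"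
    by (rule sum.reindex_bij_betw[OF e, symmetric])
  have row: "(restrict_kernel K B *\<^sub>v u) $ i = (\<Sum>j\<in>{0..<m}. pmf (K (e i)) (e j) * u $ j)"
    if "u \<in> carrier_vec m" "i < m" for u i
    using that by (auto simp: R scalar_prod_def intro!: sum.cong)
  show ?thesis
  proof
    assume "eigenvalue (restrict_kernel K B) r"
    then obtain u where u: "u \<in> carrier_vec m" "u \<noteq> 0\<^sub>v m"
      "restrict_kernel K B *\<^sub>v u = r \<cdot>\<^sub>v u"
      by (auto simp: eigenvalue_def eigenvector_def R)
    define v where "v x = u $ (the_inv_into {0..<m} e x)" for x
    have v: "v (e i) = u $ i" if "i < m" for i
      using that e by (simp add: v_def the_inv_into_f_f bij_betw_def)
    obtain i where i: "i < m" "u $ i \<noteq> 0"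
      using u(1,2) by (metis eq_vecI carrier_vecD index_zero_vec)
    have "(\<Sum>y\<in>B. pmf (K x) y * v y) = r * v x" if x: "x \<in> B" for x
    proof -
      obtain k where k: "k < m" "x = e k"
        using x e by (auto simp: bij_betw_def)
      have "(\<Sum>y\<in>B. pmf (K x) y * v y) = (restrict_kernel K B *\<^sub>v u) $ k"
        unfolding row[OF u(1) k(1)] reindex by (auto simp: k v intro!: sum.cong)
      also have "\<dots> = r * v x"
        using u(1) k by (simp add: u(3) v)
      finally show ?thesis .
    qed
    moreover have "\<exists>x\<in>B. v x \<noteq> 0"
      using i eB v by metis
    ultimately show "\<exists>v. (\<exists>x\<in>B. v x \<noteq> 0) \<and> (\<forall>x\<in>B. (\<Sum>y\<in>B. pmf (K x) y * v y) = r * v x)"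
      by blast
  next
    assume "\<exists>v. (\<exists>x\<in>B. v x \<noteq> 0) \<and> (\<forall>x\<in>B. (\<Sum>y\<in>B. pmf (K x) y * v y) = r * v x)"
    then obtain v x where v: "x \<in> B" "v x \<noteq> 0"
      "\<And>x. x \<in> B \<Longrightarrow> (\<Sum>y\<in>B. pmf (K x) y * v y) = r * v x"
      by blast
    define u where "u = vec m (\<lambda>i. v (e i))"
    have u: "u \<in> carrier_vec m"
      by (simp add: u_def)
    obtain i where i: "i < m" "x = e i"
      using v(1) e by (auto simp: bij_betw_def)
    have "u $ i \<noteq> 0"
      using i v(2) by (simp add: u_def)
    then have "u \<noteq> 0\<^sub>v m"
      using i by auto
    moreover have "restrict_kernel K B *\<^sub>v u = r \<cdot>\<^sub>v u"
    proof (rule eq_vecI)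
      fix k assume "k < dim_vec (r \<cdot>\<^sub>v u)"
      then have k: "k < m"
        by (simp add: u_def)
      have "(restrict_kernel K B *\<^sub>v u) $ k = (\<Sum>y\<in>B. pmf (K (e k)) y * v y)"
        unfolding row[OF u k] reindex by (auto simp: u_def intro!: sum.cong)
      then show "(restrict_kernel K B *\<^sub>v u) $ k = (r \<cdot>\<^sub>v u) $ k"
        using k v(3)[OF eB[OF k]] by (simp add: u_def)
    qed (simp add: R u_def)
    ultimately show "eigenvalue (restrict_kernel K B) r"
      using u by (auto simp: eigenvalue_def eigenvector_def R)
  qed
qed

end

theory Submission
  imports Defs
begin

text \<open>
  The upper bounds are the Chebyshev inequality: \<open>d(n) \<le> P(T > n)\<close>, and \<open>T\<close> is concentrated around its
  mean \<open>E\<close> at scale \<open>\<sigma>\<close>.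

  The lower bounds rest on the fact that a chain near equilibrium cannot know how much time is left
  until it hits \<open>A\<close>. At a time \<open>t < E - b\<close> the remaining time \<open>T - t\<close> lies within \<open>b\<close> of \<open>E - t\<close>, up to
  probability \<open>(\<sigma> / b)\<^sup>2\<close>. If \<open>t\<close> runs through \<open>k\<close> times with mutual distance at least \<open>2 b\<close>, these \<open>k\<close>
  windows for the remaining time are disjoint, so a chain started from the stationary distribution
  has probability at most \<open>1 / k\<close> to hit \<open>A\<close> within a suitable one of them. At that time \<open>t\<close> the distance to
  equilibrium is at least \<open>1 - (\<sigma> / b)\<^sup>2 - 1 / k\<close>. Since the distance does not increase in time, the same bound
  holds at every \<open>n\<close> that precedes \<open>E\<close> by at least \<open>(2 k + 1) b + k\<close>; this is \<open>tv_lower\<close>, with \<open>tv_upper\<close>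
  as its counterpart.

  The spectral gap enters as follows. The restricted kernel is substochastic, so \<open>1 - \<lambda>\<close> is bounded by
  a constant (\<open>spectral_gap_bounded\<close>). Hence \<open>(1 - \<lambda>) E \<rightarrow> \<infinity>\<close> forces \<open>E \<rightarrow> \<infinity>\<close>, and a positive lower limit of \<open>(1 - \<lambda>) \<sigma>\<close> keeps \<open>\<sigma>\<close>
  away from zero. With \<open>b\<close> a small multiple of \<open>E\<close>, or a large multiple of \<open>\<sigma>\<close>, the two bounds then give
  cutoff (\<open>cutoff_at_mean\<close>) and cutoff with window \<open>\<sigma>\<close> (\<open>cutoff_window_at_mean\<close>); the divergence of \<open>E\<close>, or the lower bound on \<open>\<sigma>\<close>, makes the
  rounding of times to integers harmless.
\<close>

section \<open>The Markov property and the absorbed kernel\<close>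

text \<open>
  The kernel with absorption on \<open>A\<close>: if \<open>T\<close> is the hitting time of \<open>A\<close>, then the \<open>n\<close>-th power of
  this operator maps \<open>g\<close> to \<open>x \<mapsto> E\<^sub>x[g (X\<^sub>n); T \<ge> n]\<close>. Applied to the constant \<open>1\<close> it gives the tail
  \<open>P\<^sub>x(T \<ge> n)\<close>, and applied to the indicator of \<open>A\<close> it gives \<open>P\<^sub>x(T = n)\<close>. The operator kills at the
  present state, not at the next one, so that a chain which starts in \<open>A\<close> has \<open>T = 0\<close>.
\<close>

definition killed :: "'a set \<Rightarrow> ('a \<Rightarrow> 'a pmf) \<Rightarrow> 'a set \<Rightarrow> ('a \<Rightarrow> real) \<Rightarrow> 'a \<Rightarrow> real" where
  "killed S K A g x = (if x \<in> A then 0 else \<Sum>y\<in>S. pmf (K x) y * g y)"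

locale finite_chain = prob_space M
  for M :: "'w measure" +
  fixes S :: "'a set" and K :: "'a \<Rightarrow> 'a pmf" and X :: "nat \<Rightarrow> 'w \<Rightarrow> 'a"
  assumes finite_S: "finite S"
    and markov: "markov_chain M S K X"
begin

lemma measurable_X: "X n \<in> measurable M (count_space S)"
  and kernel: "kernel_on S K"
  using markov by (auto simp: markov_chain_def)

lemma X_in_S: "\<omega> \<in> space M \<Longrightarrow> X n \<omega> \<in> S"
  using measurable_space[OF measurable_X[of n]] by simp

lemma state_event [measurable]: "{\<omega> \<in> space M. P (X n \<omega>)} \<in> events"
proof -
  have "X n -` {x\<in>S. P x} \<inter> space M \<in> events"
    by (rule measurable_sets[OF measurable_X]) auto
  also have "X n -` {x\<in>S. P x} \<inter> space M = {\<omega> \<in> space M. P (X n \<omega>)}"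
    using X_in_S by auto
  finally show ?thesis .
qed

lemma path_event [measurable]: "{\<omega> \<in> space M. \<forall>i\<le>(m::nat). X i \<omega> = z i} \<in> events"
  by (intro sets.sets_Collect_countable_All sets.sets_Collect_imp) auto

text \<open>
  A predicate \<open>H\<close> on trajectories that only looks at times up to \<open>m\<close> stands for an event of the past at
  time \<open>m\<close>. Only finitely many pasts occur, because the state space is finite.
\<close>

lemma history_event:
  assumes H: "\<And>z z'. (\<forall>i\<le>m. z i = z' i) \<Longrightarrow> H z = H z'"
  shows "{\<omega> \<in> space M. H (\<lambda>i. X i \<omega>)} \<in> events"
proof -
  have "{\<omega> \<in> space M. H (\<lambda>i. X i \<omega>)} =
      (\<Union>z\<in>{z \<in> {..m} \<rightarrow>\<^sub>E S. H z}. {\<omega> \<in> space M. \<forall>i\<le>m. X i \<omega> = z i})"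
  proof (intro equalityI subsetI)
    fix \<omega> assume w: "\<omega> \<in> {\<omega> \<in> space M. H (\<lambda>i. X i \<omega>)}"
    let ?z = "restrict (\<lambda>i. X i \<omega>) {..m}"
    have "H ?z = H (\<lambda>i. X i \<omega>)" by (rule H) auto
    then show "\<omega> \<in> (\<Union>z\<in>{z \<in> {..m} \<rightarrow>\<^sub>E S. H z}. {\<omega> \<in> space M. \<forall>i\<le>m. X i \<omega> = z i})"
      using w X_in_S by (intro UN_I[of ?z]) auto
  next
    fix \<omega> assume "\<omega> \<in> (\<Union>z\<in>{z \<in> {..m} \<rightarrow>\<^sub>E S. H z}. {\<omega> \<in> space M. \<forall>i\<le>m. X i \<omega> = z i})"
    then obtain z where "\<omega> \<in> space M" "H z" "\<forall>i\<le>m. X i \<omega> = z i" by auto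
    then show "\<omega> \<in> {\<omega> \<in> space M. H (\<lambda>i. X i \<omega>)}"
      using H[of "\<lambda>i. X i \<omega>" z] by auto
  qed
  moreover have "finite {z \<in> {..m} \<rightarrow>\<^sub>E S. H z}"
    using finite_S by (intro finite_subset[OF _ finite_PiE[of "{..m}" "\<lambda>_. S"]]) auto
  ultimately show ?thesis by (auto intro!: sets.finite_UN)
qed

lemma prob_split_state:
  assumes "{\<omega> \<in> space M. P \<omega>} \<in> events"
  shows "prob {\<omega> \<in> space M. P \<omega>} = (\<Sum>x\<in>S. prob {\<omega> \<in> space M. P \<omega> \<and> X n \<omega> = x})"
  using finite_S assms X_in_S
  by (intro prob_sum) (auto intro!: sets.sets_Collect_conj)

lemma prob_split_history:
  assumes "{\<omega> \<in> space M. P \<omega>} \<in> events"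
  shows "prob {\<omega> \<in> space M. P \<omega>} =
    (\<Sum>z\<in>{..m} \<rightarrow>\<^sub>E S. prob {\<omega> \<in> space M. P \<omega> \<and> (\<forall>i\<le>m. X i \<omega> = z i)})"
proof (rule prob_sum)
  show "finite ({..m} \<rightarrow>\<^sub>E S)" using finite_S by (auto intro: finite_PiE)
  show "AE \<omega> in M. (\<forall>z\<in>{..m} \<rightarrow>\<^sub>E S. (P \<omega> \<and> (\<forall>i\<le>m. X i \<omega> = z i)) \<longrightarrow> P \<omega>) \<and>
      (P \<omega> \<longrightarrow> (\<exists>!z\<in>{..m} \<rightarrow>\<^sub>E S. P \<omega> \<and> (\<forall>i\<le>m. X i \<omega> = z i)))"
  proof (rule AE_I2, intro conjI impI ballI)
    fix \<omega> assume w: "\<omega> \<in> space M" and "P \<omega>"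
    show "\<exists>!z\<in>{..m} \<rightarrow>\<^sub>E S. P \<omega> \<and> (\<forall>i\<le>m. X i \<omega> = z i)"
    proof (rule ex1I[of _ "restrict (\<lambda>i. X i \<omega>) {..m}"])
      fix z assume "z \<in> {..m} \<rightarrow>\<^sub>E S \<and> P \<omega> \<and> (\<forall>i\<le>m. X i \<omega> = z i)"
      then show "z = restrict (\<lambda>i. X i \<omega>) {..m}"
        by (intro ext) (auto simp: PiE_def extensional_def restrict_def)
    qed (use w \<open>P \<omega>\<close> X_in_S in auto)
  qed auto
qed (use assms in \<open>auto intro!: sets.sets_Collect_conj path_event\<close>)

lemma prob_path_Suc:
  "prob {\<omega> \<in> space M. (\<forall>i\<le>m. X i \<omega> = z i) \<and> X (Suc m) \<omega> = y} =
     prob {\<omega> \<in> space M. \<forall>i\<le>m. X i \<omega> = z i} * pmf (K (z m)) y"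
proof (cases "prob {\<omega> \<in> space M. \<forall>i\<le>m. X i \<omega> = z i} = 0")
  case True
  have "prob {\<omega> \<in> space M. (\<forall>i\<le>m. X i \<omega> = z i) \<and> X (Suc m) \<omega> = y} \<le>
      prob {\<omega> \<in> space M. \<forall>i\<le>m. X i \<omega> = z i}"
    by (rule finite_measure_mono) auto
  with True show ?thesis by (simp add: measure_le_0_iff)
next
  case False
  define z' where "z' = z(Suc m := y)"
  have eq: "(\<forall>i\<le>m. X i \<omega> = z' i) = (\<forall>i\<le>m. X i \<omega> = z i)" for \<omega>
    by (auto simp: z'_def)
  have "prob {\<omega> \<in> space M. \<forall>i\<le>m. X i \<omega> = z' i} > 0"
    using False by (simp add: eq zero_less_measure_iff)
  then have "cond_prob M (\<lambda>\<omega>. X (Suc m) \<omega> = z' (Suc m)) (\<lambda>\<omega>. \<forall>i\<le>m. X i \<omega> = z' i)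
      = pmf (K (z' m)) (z' (Suc m))"
    using markov unfolding markov_chain_def by blast
  then show ?thesis
    using False unfolding cond_prob_def eq
    by (simp add: z'_def field_simps conj_commute)
qed

text \<open>
  The chain is specified through conditioning on complete pasts of positive probability. Summing over
  the complete pasts that are compatible with \<open>H\<close> turns this into the Markov property for an arbitrary
  event of the past, without any positivity condition.
\<close>

lemma markov_step:
  assumes H: "\<And>z z'. (\<forall>i\<le>m. z i = z' i) \<Longrightarrow> H z = H z'"
  shows "prob {\<omega> \<in> space M. (H (\<lambda>i. X i \<omega>) \<and> X m \<omega> = x) \<and> X (Suc m) \<omega> = y} =
    prob {\<omega> \<in> space M. H (\<lambda>i. X i \<omega>) \<and> X m \<omega> = x} * pmf (K x) y"
proof -
  define R where "R z \<longleftrightarrow> H z \<and> z m = x" for z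
  have R: "R z = R z'" if "\<forall>i\<le>m. z i = z' i" for z z'
    using H[OF that] that by (auto simp: R_def)
  have ev: "{\<omega> \<in> space M. R (\<lambda>i. X i \<omega>)} \<in> events"
    using R by (rule history_event)
  have restr: "{\<omega> \<in> space M. R (\<lambda>i. X i \<omega>) \<and> (\<forall>i\<le>m. X i \<omega> = z i)} =
      (if R z then {\<omega> \<in> space M. \<forall>i\<le>m. X i \<omega> = z i} else {})"
    and restr_Suc: "{\<omega> \<in> space M. (R (\<lambda>i. X i \<omega>) \<and> X (Suc m) \<omega> = y) \<and> (\<forall>i\<le>m. X i \<omega> = z i)} =
      (if R z then {\<omega> \<in> space M. (\<forall>i\<le>m. X i \<omega> = z i) \<and> X (Suc m) \<omega> = y} else {})" for z
    using R[of "\<lambda>i. X i _" z] by auto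
  have term_eq: "prob {\<omega> \<in> space M. (R (\<lambda>i. X i \<omega>) \<and> X (Suc m) \<omega> = y) \<and> (\<forall>i\<le>m. X i \<omega> = z i)} =
     prob {\<omega> \<in> space M. R (\<lambda>i. X i \<omega>) \<and> (\<forall>i\<le>m. X i \<omega> = z i)} * pmf (K x) y" for z
    unfolding restr restr_Suc by (auto simp: prob_path_Suc R_def)
  have "prob {\<omega> \<in> space M. R (\<lambda>i. X i \<omega>) \<and> X (Suc m) \<omega> = y} =
    prob {\<omega> \<in> space M. R (\<lambda>i. X i \<omega>)} * pmf (K x) y"
    using ev
    by (subst (1 2) prob_split_history[where m = m])
      (auto intro!: sets.sets_Collect_conj simp: term_eq sum_distrib_right simp del: conj_assoc)
  then show ?thesis by (simp add: R_def)
qed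

text \<open>
  Conditioning at the last step before \<open>m + n\<close> and then peeling off the steps one by one replaces the
  events \<open>X\<^sub>m\<^sub>+\<^sub>i \<notin> A\<close> by powers of the absorbed kernel applied at time \<open>m\<close>.
\<close>

lemma markov_killed:
  "(\<Sum>x\<in>S. prob {\<omega> \<in> space M. (\<forall>i<n. X (m + i) \<omega> \<notin> A) \<and> X (m + n) \<omega> = x} * g x) =
   (\<Sum>x\<in>S. prob {\<omega> \<in> space M. X m \<omega> = x} * (killed S K A ^^ n) g x)"
proof (induction n arbitrary: g)
  case 0
  then show ?case by simp
next
  case (Suc n)
  define H where "H z \<longleftrightarrow> (\<forall>i<Suc n. z (m + i) \<notin> A)" for z :: "nat \<Rightarrow> 'a"
  have H: "H z = H z'" if "\<forall>i\<le>m + n. z i = z' i" for z z'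
    using that by (auto simp: H_def)
  have step: "prob {\<omega> \<in> space M. H (\<lambda>i. X i \<omega>) \<and> X (m + Suc n) \<omega> = y} =
     (\<Sum>x\<in>S. prob {\<omega> \<in> space M. H (\<lambda>i. X i \<omega>) \<and> X (m + n) \<omega> = x} * pmf (K x) y)" for y
  proof -
    have "prob {\<omega> \<in> space M. H (\<lambda>i. X i \<omega>) \<and> X (m + Suc n) \<omega> = y} =
      (\<Sum>x\<in>S. prob {\<omega> \<in> space M. (H (\<lambda>i. X i \<omega>) \<and> X (m + Suc n) \<omega> = y) \<and> X (m + n) \<omega> = x})"
      using history_event[of "m + n" H, OF H]
      by (intro prob_split_state) (auto intro!: sets.sets_Collect_conj)
    also have "\<dots> = (\<Sum>x\<in>S. prob {\<omega> \<in> space M. (H (\<lambda>i. X i \<omega>) \<and> X (m + n) \<omega> = x) \<and> X (Suc (m + n)) \<omega> = y})"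
      by (intro sum.cong refl arg_cong[where f = prob]) auto
    also have "\<dots> = (\<Sum>x\<in>S. prob {\<omega> \<in> space M. H (\<lambda>i. X i \<omega>) \<and> X (m + n) \<omega> = x} * pmf (K x) y)"
      using H by (subst markov_step) auto
    finally show ?thesis .
  qed
  have "(\<Sum>y\<in>S. prob {\<omega> \<in> space M. H (\<lambda>i. X i \<omega>) \<and> X (m + Suc n) \<omega> = y} * g y) =
    (\<Sum>y\<in>S. \<Sum>x\<in>S. prob {\<omega> \<in> space M. H (\<lambda>i. X i \<omega>) \<and> X (m + n) \<omega> = x} * pmf (K x) y * g y)"
    by (simp only: step sum_distrib_right)
  also have "\<dots> = (\<Sum>x\<in>S. prob {\<omega> \<in> space M. H (\<lambda>i. X i \<omega>) \<and> X (m + n) \<omega> = x} * (\<Sum>y\<in>S. pmf (K x) y * g y))"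
    by (subst sum.swap) (simp add: sum_distrib_left mult.assoc)
  \<comment> \<open>the condition at time \<open>m + n\<close> only involves the state \<open>x\<close> there; it becomes the absorption in \<open>killed\<close>\<close>
  also have "\<dots> = (\<Sum>x\<in>S. prob {\<omega> \<in> space M. (\<forall>i<n. X (m + i) \<omega> \<notin> A) \<and> X (m + n) \<omega> = x} * killed S K A g x)"
  proof (intro sum.cong refl)
    fix x
    have "{\<omega> \<in> space M. H (\<lambda>i. X i \<omega>) \<and> X (m + n) \<omega> = x} =
      (if x \<in> A then {} else {\<omega> \<in> space M. (\<forall>i<n. X (m + i) \<omega> \<notin> A) \<and> X (m + n) \<omega> = x})"
      by (auto simp: H_def less_Suc_eq)
    then show "prob {\<omega> \<in> space M. H (\<lambda>i. X i \<omega>) \<and> X (m + n) \<omega> = x} * (\<Sum>y\<in>S. pmf (K x) y * g y) =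
      prob {\<omega> \<in> space M. (\<forall>i<n. X (m + i) \<omega> \<notin> A) \<and> X (m + n) \<omega> = x} * killed S K A g x"
      by (simp add: killed_def)
  qed
  also have "\<dots> = (\<Sum>x\<in>S. prob {\<omega> \<in> space M. X m \<omega> = x} * (killed S K A ^^ Suc n) g x)"
    by (simp add: Suc.IH funpow_Suc_right del: funpow.simps)
  finally show ?case by (simp add: H_def)
qed

definition law :: "nat \<Rightarrow> 'a \<Rightarrow> real" where
  "law n x = prob {\<omega> \<in> space M. X n \<omega> = x}"

lemma law_nonneg: "0 \<le> law n x"
  by (simp add: law_def)

lemma prob_state: "prob {\<omega> \<in> space M. X n \<omega> \<in> B} = (\<Sum>x\<in>S. law n x * indicator B x)"
proof -
  have "prob {\<omega> \<in> space M. X n \<omega> \<in> B} = (\<Sum>x\<in>S. prob {\<omega> \<in> space M. X n \<omega> \<in> B \<and> X n \<omega> = x})"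
    by (rule prob_split_state) (rule state_event)
  also have "\<dots> = (\<Sum>x\<in>S. law n x * indicator B x)"
  proof (intro sum.cong refl)
    fix x
    have "{\<omega> \<in> space M. X n \<omega> \<in> B \<and> X n \<omega> = x} = (if x \<in> B then {\<omega> \<in> space M. X n \<omega> = x} else {})"
      by auto
    then show "prob {\<omega> \<in> space M. X n \<omega> \<in> B \<and> X n \<omega> = x} = law n x * indicator B x"
      by (simp add: law_def indicator_def)
  qed
  finally show ?thesis .
qed

lemma sum_law: "(\<Sum>x\<in>S. law n x) = 1"
  using prob_state[of n UNIV] by (simp add: prob_space)

lemma prob_avoid:
  "prob {\<omega> \<in> space M. (\<forall>i<n. X (m + i) \<omega> \<notin> A) \<and> X (m + n) \<omega> \<in> B} =
    (\<Sum>x\<in>S. law m x * (killed S K A ^^ n) (indicator B) x)"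
proof -
  define H where "H z \<longleftrightarrow> (\<forall>i<n. z (m + i) \<notin> A) \<and> z (m + n) \<in> B" for z :: "nat \<Rightarrow> 'a"
  have "{\<omega> \<in> space M. H (\<lambda>i. X i \<omega>)} \<in> events"
    by (rule history_event[of "m + n"]) (auto simp: H_def)
  then have "prob {\<omega> \<in> space M. H (\<lambda>i. X i \<omega>)} =
      (\<Sum>x\<in>S. prob {\<omega> \<in> space M. H (\<lambda>i. X i \<omega>) \<and> X (m + n) \<omega> = x})"
    by (rule prob_split_state)
  also have "\<dots> = (\<Sum>x\<in>S. prob {\<omega> \<in> space M. (\<forall>i<n. X (m + i) \<omega> \<notin> A) \<and> X (m + n) \<omega> = x} * indicator B x)"
  proof (intro sum.cong refl)
    fix x
    have "{\<omega> \<in> space M. H (\<lambda>i. X i \<omega>) \<and> X (m + n) \<omega> = x} =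
      (if x \<in> B then {\<omega> \<in> space M. (\<forall>i<n. X (m + i) \<omega> \<notin> A) \<and> X (m + n) \<omega> = x} else {})"
      by (auto simp: H_def)
    then show "prob {\<omega> \<in> space M. H (\<lambda>i. X i \<omega>) \<and> X (m + n) \<omega> = x} =
      prob {\<omega> \<in> space M. (\<forall>i<n. X (m + i) \<omega> \<notin> A) \<and> X (m + n) \<omega> = x} * indicator B x"
      by (simp add: indicator_def)
  qed
  finally show ?thesis
    by (simp add: H_def markov_killed law_def)
qed

lemma law_Suc: "(\<Sum>x\<in>S. law (Suc m) x * g x) = (\<Sum>x\<in>S. law m x * (\<Sum>y\<in>S. pmf (K x) y * g y))"
  using markov_killed[of 1 m "{}" g] by (simp add: law_def killed_def)

lemma measure_state: "measure (distr M (count_space UNIV) (X n)) B = prob {\<omega> \<in> space M. X n \<omega> \<in> B}"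
proof -
  have "X n \<in> measurable M (count_space UNIV)"
    using state_event[of "\<lambda>x. x \<in> _" n] unfolding measurable_def by (auto simp: vimage_def Int_def conj_commute)
  then show ?thesis
    by (simp add: measure_distr vimage_def Int_def conj_commute)
qed

lemma kernel_sum: "x \<in> S \<Longrightarrow> (\<Sum>y\<in>S. pmf (K x) y) = 1"
  using kernel finite_S by (intro sum_pmf_eq_1) (auto simp: kernel_on_def)

end

section \<open>Total variation distance to the stationary distribution\<close>

locale halting_chain = finite_chain M S K X
  for M :: "'w measure" and S :: "'a set" and K X +
  fixes p :: "'a pmf" and A :: "'a set"
  assumes irreducible: "irreducible_on S K"
    and stationary: "stationary_on S K p"
    and A_sub: "A \<subseteq> S" and A_ne: "A \<noteq> {}"
    and halting: "tv_halting_set M X p A"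
begin

lemma set_p: "set_pmf p \<subseteq> S"
  using stationary by (simp add: stationary_on_def)

lemma sum_p: "(\<Sum>x\<in>S. pmf p x) = 1"
  using set_p finite_S by (intro sum_pmf_eq_1)

lemma measure_p: "measure (measure_pmf p) B = (\<Sum>x\<in>S. pmf p x * indicator B x)"
proof -
  have "measure (measure_pmf p) B = measure (measure_pmf p) (S \<inter> B)"
    using set_p by (intro measure_pmf.finite_measure_eq_AE) (auto simp: AE_measure_pmf_iff)
  also have "\<dots> = (\<Sum>x\<in>S \<inter> B. pmf p x)"
    using finite_S by (intro measure_measure_pmf_finite) auto
  also have "\<dots> = (\<Sum>x\<in>S. pmf p x * indicator B x)"
    unfolding sum.inter_restrict[OF finite_S] by (intro sum.cong) (auto simp: indicator_def)
  finally show ?thesis .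
qed

lemma p_step: "(\<Sum>x\<in>S. pmf p x * g x) = (\<Sum>x\<in>S. pmf p x * (\<Sum>y\<in>S. pmf (K x) y * g y))"
proof -
  have p_eq: "pmf p y = (\<Sum>x\<in>S. pmf p x * pmf (K x) y)" for y
  proof -
    have "pmf p y = pmf (bind_pmf p K) y"
      using stationary by (simp add: stationary_on_def)
    also have "\<dots> = (\<Sum>x\<in>S. pmf p x * pmf (K x) y)"
      using set_p finite_S unfolding pmf_bind by (subst integral_measure_pmf[of S]) auto
    finally show ?thesis .
  qed
  have "(\<Sum>y\<in>S. pmf p y * g y) = (\<Sum>y\<in>S. (\<Sum>x\<in>S. pmf p x * pmf (K x) y) * g y)"
    by (intro sum.cong refl arg_cong2[where f = "(*)"] p_eq)
  also have "\<dots> = (\<Sum>x\<in>S. pmf p x * (\<Sum>y\<in>S. pmf (K x) y * g y))"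
    unfolding sum_distrib_left sum_distrib_right mult.assoc by (rule sum.swap)
  finally show ?thesis .
qed

abbreviation tv :: "nat \<Rightarrow> real" where
  "tv \<equiv> tv_to M X p"

lemma tv_eq: "tv n = (SUP B. \<bar>\<Sum>x\<in>S. (law n x - pmf p x) * indicator B x\<bar>)"
  by (simp add: tv_to_def tv_dist_def measure_state prob_state measure_p
      sum_subtractf[symmetric] left_diff_distrib)

lemma event_diff_le_1: "\<bar>\<Sum>x\<in>S. (law n x - pmf p x) * indicator B x\<bar> \<le> 1"
proof -
  have "(\<Sum>x\<in>S. (law n x - pmf p x) * indicator B x) =
      prob {\<omega> \<in> space M. X n \<omega> \<in> B} - measure (measure_pmf p) B"
    by (simp add: prob_state measure_p sum_subtractf[symmetric] left_diff_distrib)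
  moreover have "prob {\<omega> \<in> space M. X n \<omega> \<in> B} \<le> 1" "measure (measure_pmf p) B \<le> 1"
    by (auto simp: measure_pmf.prob_le_1)
  ultimately show ?thesis
    by (smt (verit) measure_nonneg)
qed

lemma tv_ge_event: "\<bar>\<Sum>x\<in>S. (law n x - pmf p x) * indicator B x\<bar> \<le> tv n"
  unfolding tv_eq by (rule cSUP_upper) (auto intro!: bdd_aboveI2[where M = 1] event_diff_le_1)

lemma tv_nonneg: "0 \<le> tv n"
  using tv_ge_event[of n "{}"] by simp

lemma tv_le_1: "tv n \<le> 1"
  unfolding tv_eq by (rule cSUP_least) (auto intro: event_diff_le_1)

text \<open>
  The total variation distance controls test functions with values in \<open>[0, 1]\<close> and not only events,
  since the difference of the two integrals is largest for the indicator of the set where the law of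
  \<open>X\<^sub>n\<close> exceeds \<open>p\<close>.
\<close>

lemma tv_ge_function_aux:
  assumes f: "\<And>x. x \<in> S \<Longrightarrow> 0 \<le> f x \<and> f x \<le> 1"
  shows "(\<Sum>x\<in>S. (law n x - pmf p x) * f x) \<le> tv n"
proof -
  let ?B = "{x. law n x > pmf p x}"
  have "(\<Sum>x\<in>S. (law n x - pmf p x) * f x) \<le> (\<Sum>x\<in>S. (law n x - pmf p x) * indicator ?B x)"
    using f by (intro sum_mono) (auto simp: indicator_def mult_le_0_iff intro!: mult_right_le_one_le)
  also have "\<dots> \<le> tv n"
    using tv_ge_event[of n ?B] by linarith
  finally show ?thesis .
qed

lemma tv_ge_function:
  assumes f: "\<And>x. x \<in> S \<Longrightarrow> 0 \<le> f x \<and> f x \<le> 1"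
  shows "\<bar>\<Sum>x\<in>S. (law n x - pmf p x) * f x\<bar> \<le> tv n"
proof -
  have "(\<Sum>x\<in>S. (law n x - pmf p x) * (1 - f x)) = - (\<Sum>x\<in>S. (law n x - pmf p x) * f x)"
    by (simp add: right_diff_distrib sum_subtractf sum_law sum_p)
  then show ?thesis
    using tv_ge_function_aux[of f n] tv_ge_function_aux[of "\<lambda>x. 1 - f x" n] f by (force simp: abs_le_iff)
qed

text \<open>
  An event at time \<open>Suc n\<close> is a test function at time \<open>n\<close>, through one step of the kernel, and the
  integral of that function under \<open>p\<close> is the probability of the event by stationarity.
\<close>

lemma tv_Suc_le: "tv (Suc n) \<le> tv n"
proof -
  have "\<bar>\<Sum>x\<in>S. (law (Suc n) x - pmf p x) * indicator B x\<bar> \<le> tv n" for B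
  proof -
    define f where "f x = (\<Sum>y\<in>S. pmf (K x) y * indicator B y)" for x
    have "0 \<le> f x \<and> f x \<le> 1" if "x \<in> S" for x
    proof -
      have "f x \<le> (\<Sum>y\<in>S. pmf (K x) y)"
        unfolding f_def by (intro sum_mono) (auto simp: indicator_def)
      then show ?thesis
        using kernel_sum[OF that] by (auto simp: f_def intro!: sum_nonneg)
    qed
    then have "\<bar>\<Sum>x\<in>S. (law n x - pmf p x) * f x\<bar> \<le> tv n"
      by (rule tv_ge_function)
    moreover have "(\<Sum>x\<in>S. (law (Suc n) x - pmf p x) * indicator B x) = (\<Sum>x\<in>S. (law n x - pmf p x) * f x)"
      unfolding left_diff_distrib sum_subtractf law_Suc p_step[of "indicator B"] f_def ..
    ultimately show ?thesis by simp
  qed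
  then show ?thesis
    unfolding tv_eq[of "Suc n"] by (intro cSUP_least) auto
qed

lemma tv_antimono: "m \<le> n \<Longrightarrow> tv n \<le> tv m"
  using tv_Suc_le by (rule lift_Suc_antimono_le)

section \<open>First passage probabilities and moments of the hitting time\<close>

abbreviation Q :: "nat \<Rightarrow> ('a \<Rightarrow> real) \<Rightarrow> 'a \<Rightarrow> real" where
  "Q n \<equiv> killed S K A ^^ n"

lemma killed_mono:
  assumes "\<And>y. y \<in> S \<Longrightarrow> g y \<le> h y"
  shows "killed S K A g x \<le> killed S K A h x"
  using assms by (auto simp: killed_def intro!: sum_mono mult_left_mono)

lemma Q_mono:
  assumes "\<And>y. y \<in> S \<Longrightarrow> g y \<le> h y" and "x \<in> S"
  shows "Q n g x \<le> Q n h x"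
  using \<open>x \<in> S\<close>
proof (induction n arbitrary: x)
  case (Suc n)
  then show ?case by (auto intro: killed_mono)
qed (use assms in simp)

lemma Q_diff: "Q n (\<lambda>y. g y - h y) x = Q n g x - Q n h x"
proof (induction n arbitrary: x)
  case (Suc n)
  then have "Q n (\<lambda>y. g y - h y) = (\<lambda>x. Q n g x - Q n h x)" by auto
  then show ?case by (simp add: killed_def[of S K A _ x] right_diff_distrib sum_subtractf)
qed simp

lemma Q_scale: "Q n (\<lambda>y. c * g y) x = c * Q n g x"
proof (induction n arbitrary: x)
  case (Suc n)
  then have "Q n (\<lambda>y. c * g y) = (\<lambda>x. c * Q n g x)" by auto
  then show ?case by (simp add: killed_def[of S K A _ x] sum_distrib_left mult.left_commute)
qed simp

lemma Q_nonneg: "x \<in> S \<Longrightarrow> (\<And>y. y \<in> S \<Longrightarrow> 0 \<le> g y) \<Longrightarrow> 0 \<le> Q n g x"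
  using Q_mono[of "\<lambda>_. 0" g x n] Q_scale[of n 0 "\<lambda>_. 0" x] by simp

lemma killed_one: "x \<in> S \<Longrightarrow> killed S K A (\<lambda>_. 1) x = 1 - indicator A x"
  by (simp add: killed_def kernel_sum)

text \<open>
  \<open>P\<^sub>x(T = n) = P\<^sub>x(T \<ge> n) - P\<^sub>x(T \<ge> n + 1)\<close>; the sums of the left-hand side telescope.
\<close>

lemma first_passage:
  assumes "x \<in> S"
  shows "Q n (indicator A) x = Q n (\<lambda>_. 1) x - Q (Suc n) (\<lambda>_. 1) x"
proof -
  have "Q (Suc n) (\<lambda>_. 1) x = Q n (killed S K A (\<lambda>_. 1)) x"
    by (simp add: funpow_Suc_right del: funpow.simps)
  also have "\<dots> = Q n (\<lambda>y. 1 - indicator A y) x"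
    using assms by (intro antisym Q_mono) (auto simp: killed_one)
  finally show ?thesis by (simp add: Q_diff)
qed

lemma Q_one_Suc_le: "x \<in> S \<Longrightarrow> Q (Suc n) (\<lambda>_. 1) x \<le> Q n (\<lambda>_. 1) x"
  using first_passage[of x n] Q_nonneg[of x "indicator A" n] by simp

lemma Q_one_antimono: "x \<in> S \<Longrightarrow> m \<le> n \<Longrightarrow> Q n (\<lambda>_. 1) x \<le> Q m (\<lambda>_. 1) x"
  using Q_one_Suc_le by (rule lift_Suc_antimono_le[of "\<lambda>n. Q n (\<lambda>_. 1) x"])

lemma Q_one_le_1: "x \<in> S \<Longrightarrow> Q n (\<lambda>_. 1) x \<le> 1"
  using Q_one_antimono[of x 0 n] by simp

lemma sum_first_passage_le_1:
  assumes "x \<in> S" "finite J"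
  shows "(\<Sum>j\<in>J. Q j (indicator A) x) \<le> 1"
proof -
  obtain n where n: "J \<subseteq> {..<n}"
    using assms(2) by (metis finite_nat_iff_bounded)
  have "(\<Sum>j\<in>J. Q j (indicator A) x) \<le> (\<Sum>j<n. Q j (indicator A) x)"
    using assms n by (intro sum_mono2) (auto intro!: Q_nonneg)
  also have "\<dots> = 1 - Q n (\<lambda>_. 1) x"
    unfolding first_passage[OF assms(1)] by (subst sum_lessThan_telescope') simp
  also have "\<dots> \<le> 1"
    using Q_nonneg[OF assms(1), of "\<lambda>_. 1" n] by simp
  finally show ?thesis .
qed

text \<open>
  The states from which the chain almost surely avoids \<open>A\<close> form a set that the chain cannot leave and
  that does not meet \<open>A\<close>. By irreducibility this set is empty.
\<close>

lemma may_hit: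
  assumes "x \<in> S"
  shows "\<exists>n. Q n (\<lambda>_. 1) x < 1"
proof (rule ccontr)
  define C where "C = {x \<in> S. \<forall>n. Q n (\<lambda>_. 1) x = 1}"
  assume "\<not> (\<exists>n. Q n (\<lambda>_. 1) x < 1)"
  then have "x \<in> C"
    using assms Q_one_le_1[of x] by (force simp: C_def not_less intro: antisym)
  have C_A: "z \<notin> A" if "z \<in> C" for z
  proof
    assume "z \<in> A"
    then have "Q 1 (\<lambda>_. 1) z = 0" by (simp add: killed_def)
    moreover have "Q 1 (\<lambda>_. 1) z = 1" using that unfolding C_def by blast
    ultimately show False by simp
  qed
  have C_K: "set_pmf (K z) \<subseteq> C" if z: "z \<in> C" for z
  proof
    fix y assume y: "y \<in> set_pmf (K z)"
    have zS: "z \<in> S" using z by (simp add: C_def)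
    with y have yS: "y \<in> S" using kernel by (auto simp: kernel_on_def)
    have "Q n (\<lambda>_. 1) y = 1" for n
    proof -
      have "(\<Sum>w\<in>S. pmf (K z) w * (1 - Q n (\<lambda>_. 1) w)) = 1 - Q (Suc n) (\<lambda>_. 1) z"
        using C_A[OF z] by (simp add: right_diff_distrib sum_subtractf kernel_sum[OF zS] killed_def[of S K A _ z])
      also have "\<dots> = 0"
      proof -
        have "Q (Suc n) (\<lambda>_. 1) z = 1" using z unfolding C_def by blast
        then show ?thesis by (simp only: diff_self)
      qed
      finally have "\<forall>w\<in>S. pmf (K z) w * (1 - Q n (\<lambda>_. 1) w) = 0"
        using finite_S by (subst (asm) sum_nonneg_eq_0_iff) (auto simp: Q_one_le_1)
      then show ?thesis
        using yS y by (auto simp: set_pmf_iff)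
    qed
    with yS show "y \<in> C" by (simp add: C_def)
  qed
  have C_n: "set_pmf (n_step K n x) \<subseteq> C" for n
  proof (induction n)
    case 0
    then show ?case using \<open>x \<in> C\<close> by (simp add: n_step_def)
  next
    case (Suc n)
    then show ?case using C_K by (force simp: n_step_def)
  qed
  obtain a where "a \<in> A" using A_ne by auto
  then obtain n where "pmf (n_step K n x) a > 0"
    using irreducible assms A_sub unfolding irreducible_on_def by (meson subsetD)
  then have "a \<in> C" using C_n[of n] by (auto simp: set_pmf_iff)
  with C_A \<open>a \<in> A\<close> show False by blast
qed

lemma uniform_hit: "\<exists>m \<delta>. 0 \<le> \<delta> \<and> \<delta> < 1 \<and> (\<forall>x\<in>S. Q m (\<lambda>_. 1) x \<le> \<delta>)"
proof -
  obtain n where n: "\<And>x. x \<in> S \<Longrightarrow> Q (n x) (\<lambda>_. 1) x < 1"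
    using may_hit by metis
  define m where "m = Max (n ` S)"
  define \<delta> where "\<delta> = Max (insert 0 (Q m (\<lambda>_. 1) ` S))"
  have "Q m (\<lambda>_. 1) x < 1" if "x \<in> S" for x
    using Q_one_antimono[OF that, of "n x" m] n[OF that] that finite_S by (simp add: m_def)
  then have "\<delta> < 1" "0 \<le> \<delta>" "\<forall>x\<in>S. Q m (\<lambda>_. 1) x \<le> \<delta>"
    using finite_S by (auto simp: \<delta>_def)
  then show ?thesis by blast
qed

lemma avoid_event: "{\<omega> \<in> space M. \<forall>i<n. X i \<omega> \<notin> A} \<in> events"
  by (rule history_event[of n]) auto

lemma prob_avoid_from_start: "prob {\<omega> \<in> space M. \<forall>i<n. X i \<omega> \<notin> A} = (\<Sum>x\<in>S. law 0 x * Q n (\<lambda>_. 1) x)"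
  using prob_avoid[of n 0 A UNIV] by simp

text \<open>
  By finiteness one time \<open>m\<close> and one bound \<open>\<delta> < 1\<close> serve all starting points, and every block of length
  \<open>m\<close> costs another factor \<open>\<delta>\<close>. So the hitting time is almost surely finite and has all moments; its
  mean and variance are then genuine ones rather than default values of a divergent integral.
\<close>

lemma geometric_tail:
  obtains m \<delta> where "0 \<le> \<delta>" "\<delta> < 1" "m > 0"
    "\<And>k. prob {\<omega> \<in> space M. \<forall>i<k * m. X i \<omega> \<notin> A} \<le> \<delta> ^ k"
proof -
  obtain m \<delta> where d: "0 \<le> \<delta>" "\<delta> < 1" "\<And>x. x \<in> S \<Longrightarrow> Q m (\<lambda>_. 1) x \<le> \<delta>"
    using uniform_hit by blast
  have "m \<noteq> 0"
  proof
    assume "m = 0"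
    moreover obtain a where "a \<in> A" using A_ne by auto
    ultimately show False using d(2) d(3)[of a] A_sub by auto
  qed
  have pow: "Q (k * m) (\<lambda>_. 1) x \<le> \<delta> ^ k" if "x \<in> S" for k x
    using that
  proof (induction k arbitrary: x)
    case (Suc k)
    have "Q (Suc k * m) (\<lambda>_. 1) x = Q m (Q (k * m) (\<lambda>_. 1)) x"
      by (simp add: funpow_add)
    also have "\<dots> \<le> Q m (\<lambda>y. \<delta> ^ k * 1) x"
      using Suc by (intro Q_mono) auto
    also have "\<dots> = \<delta> ^ k * Q m (\<lambda>_. 1) x"
      by (rule Q_scale)
    also have "\<dots> \<le> \<delta> ^ k * \<delta>"
      using d Suc.prems by (intro mult_left_mono) auto
    finally show ?case by (simp add: mult.commute)
  qed simp
  have "prob {\<omega> \<in> space M. \<forall>i<k * m. X i \<omega> \<notin> A} \<le> \<delta> ^ k" for k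
  proof -
    have "prob {\<omega> \<in> space M. \<forall>i<k * m. X i \<omega> \<notin> A} \<le> (\<Sum>x\<in>S. law 0 x * \<delta> ^ k)"
      unfolding prob_avoid_from_start using pow by (intro sum_mono mult_left_mono law_nonneg)
    then show ?thesis by (simp add: sum_law flip: sum_distrib_right)
  qed
  with d \<open>m \<noteq> 0\<close> show ?thesis by (intro that) auto
qed

abbreviation T :: "'w \<Rightarrow> real" where
  "T \<equiv> real_hitting_time X A"

lemma hitting_time_gt_iff: "hitting_time X A \<omega> > enat n \<longleftrightarrow> (\<forall>i\<le>n. X i \<omega> \<notin> A)"
proof -
  have "hitting_time X A \<omega> > enat n \<longleftrightarrow> enat (Suc n) \<le> hitting_time X A \<omega>"
    by (rule Suc_ile_eq[symmetric])
  also have "\<dots> \<longleftrightarrow> (\<forall>i. X i \<omega> \<in> A \<longrightarrow> Suc n \<le> i)"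
    by (simp add: hitting_time_def le_INF_iff)
  also have "\<dots> \<longleftrightarrow> (\<forall>i\<le>n. X i \<omega> \<notin> A)"
    by (metis not_less_eq_eq)
  finally show ?thesis .
qed

lemma hitting_time_eqI: "X t \<omega> \<in> A \<Longrightarrow> (\<And>i. i < t \<Longrightarrow> X i \<omega> \<notin> A) \<Longrightarrow> hitting_time X A \<omega> = enat t"
  unfolding hitting_time_def by (rule antisym[OF INF_lower INF_greatest]) (auto simp: not_less[symmetric])

lemma T_eqI: "X t \<omega> \<in> A \<Longrightarrow> (\<And>i. i < t \<Longrightarrow> X i \<omega> \<notin> A) \<Longrightarrow> T \<omega> = real t"
  by (simp add: real_hitting_time_def hitting_time_eqI)

lemma T_never: "(\<And>i. X i \<omega> \<notin> A) \<Longrightarrow> T \<omega> = 0"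
  by (simp add: real_hitting_time_def hitting_time_def top_enat_def)

lemma T_first_hit:
  assumes "X i \<omega> \<in> A"
  defines "t \<equiv> LEAST i. X i \<omega> \<in> A"
  shows "X t \<omega> \<in> A" and "\<And>i. i < t \<Longrightarrow> X i \<omega> \<notin> A" and "T \<omega> = real t"
proof -
  show 1: "X t \<omega> \<in> A" unfolding t_def using assms(1) by (rule LeastI)
  show 2: "\<And>i. i < t \<Longrightarrow> X i \<omega> \<notin> A" unfolding t_def by (rule not_less_Least)
  show "T \<omega> = real t" using 1 2 by (rule T_eqI)
qed

lemma T_cases:
  obtains (never) "\<And>i. X i \<omega> \<notin> A" "T \<omega> = 0"
  | (hit) t where "X t \<omega> \<in> A" "\<And>i. i < t \<Longrightarrow> X i \<omega> \<notin> A" "T \<omega> = real t"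
proof (cases "\<exists>i. X i \<omega> \<in> A")
  case True
  then obtain i where "X i \<omega> \<in> A" by blast
  from T_first_hit[OF this] show ?thesis by (rule hit)
next
  case False
  then have "X i \<omega> \<notin> A" for i by blast
  from this T_never[OF this] show ?thesis by (rule never)
qed

lemma T_measurable: "T \<in> borel_measurable M"
proof -
  have T_eq: "T = (\<lambda>\<omega>. if \<exists>i. X i \<omega> \<in> A then real (LEAST i. X i \<omega> \<in> A) else 0)"
    by (intro ext) (metis T_first_hit(3) T_never)
  have [measurable]: "Measurable.pred M (\<lambda>\<omega>. X i \<omega> \<in> A)" for i
    by (simp add: pred_def state_event)
  show ?thesis unfolding T_eq by measurable
qed

text \<open>
  If \<open>q m \<le> T < (q + 1) m\<close>, then \<open>T\<^sup>2 \<le> m\<^sup>2 (q + 1)\<^sup>2\<close>, and \<open>(q + 1)\<^sup>2\<close> is the sum of \<open>2 k + 1\<close> over \<open>k \<le> q\<close>,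
  that is, over all \<open>k\<close> with \<open>T \<ge> k m\<close>. The expectation is thus at most a series that converges by
  the geometric tail.
\<close>

lemma T_square_integrable: "integrable M (\<lambda>\<omega>. (T \<omega>)\<^sup>2)"
proof -
  obtain m \<delta> where d: "0 \<le> \<delta>" "\<delta> < 1" "m > 0"
    and tail: "\<And>k. prob {\<omega> \<in> space M. \<forall>i<k * m. X i \<omega> \<notin> A} \<le> \<delta> ^ k"
    by (rule geometric_tail) (rule that)
  define B where "B k = {\<omega> \<in> space M. \<forall>i<k * m. X i \<omega> \<notin> A}" for k
  have B [measurable]: "B k \<in> events" for k
    unfolding B_def by (rule avoid_event)
  have bound: "ennreal ((T \<omega>)\<^sup>2) \<le> (\<Sum>k. ennreal ((real m)\<^sup>2 * (2 * real k + 1)) * indicator (B k) \<omega>)"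
    if w: "\<omega> \<in> space M" for \<omega>
  proof (cases rule: T_cases[of \<omega>])
    case (hit t)
    define q where "q = t div m"
    have "t < m * Suc q"
      using d(3) by (simp add: q_def dividend_less_times_div add.commute)
    then have "T \<omega> \<le> real m * real (Suc q)"
      unfolding hit(3) of_nat_mult[symmetric] by (intro of_nat_mono) simp
    then have "(T \<omega>)\<^sup>2 \<le> (real m * real (Suc q))\<^sup>2"
      using hit(3) by (intro power_mono) auto
    also have "\<dots> = (real m)\<^sup>2 * (\<Sum>k<Suc q. 2 * real k + 1)"
    proof -
      have "(\<Sum>k<n. 2 * real k + 1) = (real n)\<^sup>2" for n
        by (induction n) (auto simp: power2_eq_square algebra_simps)
      then show ?thesis by (simp only: power_mult_distrib)
    qed
    also have "ennreal \<dots> = (\<Sum>k<Suc q. ennreal ((real m)\<^sup>2 * (2 * real k + 1)))"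
      unfolding sum_distrib_left by (subst sum_ennreal) auto
    also have "\<dots> = (\<Sum>k<Suc q. ennreal ((real m)\<^sup>2 * (2 * real k + 1)) * indicator (B k) \<omega>)"
    proof (intro sum.cong refl)
      fix k assume "k \<in> {..<Suc q}"
      then have "k * m \<le> q * m" by simp
      also have "\<dots> \<le> t" by (simp add: q_def)
      finally have "\<omega> \<in> B k" using hit(2) w by (auto simp: B_def)
      then show "ennreal ((real m)\<^sup>2 * (2 * real k + 1)) =
        ennreal ((real m)\<^sup>2 * (2 * real k + 1)) * indicator (B k) \<omega>" by simp
    qed
    also have "\<dots> \<le> (\<Sum>k. ennreal ((real m)\<^sup>2 * (2 * real k + 1)) * indicator (B k) \<omega>)"
      by (intro sum_le_suminf) auto
    finally show ?thesis by (simp add: ennreal_leI)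
  qed simp
  have "(\<integral>\<^sup>+\<omega>. ennreal ((T \<omega>)\<^sup>2) \<partial>M) \<le> (\<integral>\<^sup>+\<omega>. (\<Sum>k. ennreal ((real m)\<^sup>2 * (2 * real k + 1)) * indicator (B k) \<omega>) \<partial>M)"
    by (intro nn_integral_mono bound)
  also have "\<dots> = (\<Sum>k. ennreal ((real m)\<^sup>2 * (2 * real k + 1)) * emeasure M (B k))"
    by (subst nn_integral_suminf) (auto simp: nn_integral_cmult_indicator)
  also have "\<dots> \<le> (\<Sum>k. ennreal ((real m)\<^sup>2 * (2 * real k + 1) * \<delta> ^ k))"
  proof (intro suminf_le summableI)
    fix k
    show "ennreal ((real m)\<^sup>2 * (2 * real k + 1)) * emeasure M (B k) \<le> ennreal ((real m)\<^sup>2 * (2 * real k + 1) * \<delta> ^ k)"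
      using tail[of k] d(1) unfolding B_def[symmetric]
      by (auto simp: emeasure_eq_measure ennreal_mult[symmetric] intro!: ennreal_leI mult_left_mono)
  qed
  also have "\<dots> < \<infinity>"
  proof -
    have "summable (\<lambda>k. real (Suc k) * \<delta> ^ k)" "summable (\<lambda>k. \<delta> ^ k)"
      using geometric_deriv_sums[of \<delta>] d by (auto simp: sums_iff intro!: summable_geometric)
    then have "summable (\<lambda>k. (real m)\<^sup>2 * (2 * (real (Suc k) * \<delta> ^ k) - \<delta> ^ k))"
      by (intro summable_mult summable_diff)
    then have "summable (\<lambda>k. (real m)\<^sup>2 * (2 * real k + 1) * \<delta> ^ k)"
      by (simp add: algebra_simps)
    then show ?thesis
      using d(1) by (subst suminf_ennreal2) auto
  qed
  finally have "(\<integral>\<^sup>+\<omega>. ennreal ((T \<omega>)\<^sup>2) \<partial>M) < \<infinity>" .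
  then show ?thesis
    using T_measurable by (intro integrableI_nonneg) auto
qed

section \<open>Bounds on the distance at a fixed time\<close>

abbreviation mean :: real where "mean \<equiv> mean_hit M X A"
abbreviation sd :: real where "sd \<equiv> sd_hit M X A"

lemma mean_nonneg: "0 \<le> mean"
  unfolding mean_hit_def by (rule Bochner_Integration.integral_nonneg) (auto simp: real_hitting_time_def real_of_ereal_pos)

lemma sd_nonneg: "0 \<le> sd"
  by (simp add: sd_hit_def)

lemma chebyshev:
  assumes "b > 0"
  shows "prob {\<omega> \<in> space M. \<bar>T \<omega> - mean\<bar> \<ge> b} \<le> (sd / b)\<^sup>2"
proof -
  have "sd\<^sup>2 = variance T"
    unfolding sd_hit_def by (rule real_sqrt_pow2) (simp add: Bochner_Integration.integral_nonneg)
  then show ?thesis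
    using Chebyshev_inequality[OF T_measurable T_square_integrable assms]
    by (simp add: mean_hit_def power_divide)
qed

text \<open>
  The halting property followed by the Chebyshev inequality. The trajectories that never hit \<open>A\<close>,
  for which \<open>T\<close> has the default value \<open>0\<close>, form a null set and are treated apart.
\<close>

lemma tv_upper:
  assumes b: "b > 0" and n: "mean + b < real n + 1"
  shows "tv n \<le> (sd / b)\<^sup>2"
proof -
  obtain m \<delta> where d: "0 \<le> \<delta>" "\<delta> < 1" "m > 0"
    and tail: "\<And>k. prob {\<omega> \<in> space M. \<forall>i<k * m. X i \<omega> \<notin> A} \<le> \<delta> ^ k"
    by (rule geometric_tail) (rule that)
  have dev: "{\<omega> \<in> space M. \<bar>T \<omega> - mean\<bar> \<ge> b} \<in> events"
    using T_measurable by measurable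
  have "tv n \<le> prob {\<omega> \<in> space M. \<forall>i\<le>n. X i \<omega> \<notin> A}"
    using halting by (simp add: tv_halting_set_def hitting_time_gt_iff)
  also have "\<dots> \<le> (sd / b)\<^sup>2 + \<delta> ^ k" for k
  proof -
    have "prob {\<omega> \<in> space M. \<forall>i\<le>n. X i \<omega> \<notin> A} \<le>
        prob ({\<omega> \<in> space M. \<bar>T \<omega> - mean\<bar> \<ge> b} \<union> {\<omega> \<in> space M. \<forall>i<k * m. X i \<omega> \<notin> A})"
    proof (rule finite_measure_mono)
      show "{\<omega> \<in> space M. \<forall>i\<le>n. X i \<omega> \<notin> A} \<subseteq>
        {\<omega> \<in> space M. \<bar>T \<omega> - mean\<bar> \<ge> b} \<union> {\<omega> \<in> space M. \<forall>i<k * m. X i \<omega> \<notin> A}"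
      proof (intro subsetI)
        fix \<omega> assume w: "\<omega> \<in> {\<omega> \<in> space M. \<forall>i\<le>n. X i \<omega> \<notin> A}"
        show "\<omega> \<in> {\<omega> \<in> space M. \<bar>T \<omega> - mean\<bar> \<ge> b} \<union> {\<omega> \<in> space M. \<forall>i<k * m. X i \<omega> \<notin> A}"
        proof (cases rule: T_cases[of \<omega>])
          case never
          then show ?thesis using w by auto
        next
          case (hit t)
          then have "Suc n \<le> t" using w by (metis (mono_tags, lifting) mem_Collect_eq not_less_eq_eq)
          then have "real n + 1 \<le> T \<omega>" using hit(3) by simp
          then show ?thesis using n w by auto
        qed
      qed
    qed (use dev avoid_event in auto)
    also have "\<dots> \<le> prob {\<omega> \<in> space M. \<bar>T \<omega> - mean\<bar> \<ge> b} + prob {\<omega> \<in> space M. \<forall>i<k * m. X i \<omega> \<notin> A}"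
      using dev avoid_event by (intro measure_Un_le)
    also have "\<dots> \<le> (sd / b)\<^sup>2 + \<delta> ^ k"
      using chebyshev[OF b] tail by (intro add_mono)
    finally show ?thesis .
  qed
  finally have le: "tv n \<le> (sd / b)\<^sup>2 + \<delta> ^ k" for k .
  have "(\<lambda>k. (sd / b)\<^sup>2 + \<delta> ^ k) \<longlonglongrightarrow> (sd / b)\<^sup>2 + 0"
    using d by (intro tendsto_add tendsto_const LIMSEQ_realpow_zero)
  from LIMSEQ_le_const[OF this] le show ?thesis by auto
qed

text \<open>
  Consider the times \<open>t\<^sub>i = n + i w\<close> for \<open>i < k\<close>. The state at time \<open>t\<^sub>i\<close> is typically one from which the
  remaining time to \<open>A\<close> lies within \<open>b\<close> of \<open>mean - t\<^sub>i\<close>. The step \<open>w\<close> makes these \<open>k\<close> windows for the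
  remaining time disjoint, so under the stationary distribution, which does not depend on \<open>i\<close>, their
  probabilities add up to at most \<open>1\<close> and one of them is at most \<open>1 / k\<close>. At the corresponding time
  \<open>t\<^sub>i\<close> the law of the chain is therefore far from stationary, and at the earlier time \<open>n\<close> it is at
  least as far. The hypothesis on \<open>n\<close> makes room for all \<open>k\<close> windows before the mean.
\<close>

lemma tv_lower:
  assumes b: "b > 0" and k: "k > 0" and n: "real n + (2 * real k + 1) * b + real k \<le> mean"
  shows "1 - (sd / b)\<^sup>2 - 1 / real k \<le> tv n"
proof -
  define w where "w = nat \<lceil>2 * b\<rceil>"
  have w: "2 * b \<le> real w" "real w \<le> 2 * b + 1"
    using b by (auto simp: w_def)
  define t where "t i = n + i * w" for i
  define J where "J i = {j. \<bar>real (t i + j) - mean\<bar> < b}" for i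
  \<comment> \<open>\<open>f i x\<close> is the probability that the hitting time from \<open>x\<close> falls into the window \<open>J i\<close>\<close>
  define f where "f i x = (\<Sum>j\<in>J i. Q j (indicator A) x)" for i x
  have finJ: "finite (J i)" for i
  proof (rule finite_subset)
    show "J i \<subseteq> {..nat \<lceil>mean + b\<rceil>}"
      by (auto simp: J_def le_nat_iff) linarith
  qed simp
  have disj_less: "J i \<inter> J i' = {}" if "i < i'" for i i'
  proof -
    have "Suc i * w \<le> i' * w" using that by (intro mult_right_mono) auto
    then have "t i + w \<le> t i'" by (simp add: t_def)
    then have "real (t i) + real w \<le> real (t i')" by (metis of_nat_add of_nat_mono)
    then show ?thesis using w(1) by (auto simp: J_def)
  qed
  have disj: "J i \<inter> J i' = {}" if "i \<noteq> i'" for i i'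
    using that disj_less[of i i'] disj_less[of i' i] by (cases i i' rule: linorder_cases) (simp_all add: Int_commute)
  have f01: "0 \<le> f i x \<and> f i x \<le> 1" if "x \<in> S" for i x
    using that finJ[of i] sum_first_passage_le_1 by (auto simp: f_def intro!: sum_nonneg Q_nonneg)
  have sum_f: "(\<Sum>i<k. f i x) \<le> 1" if x: "x \<in> S" for x
  proof -
    have "(\<Sum>i<k. f i x) = (\<Sum>j\<in>(\<Union>i<k. J i). Q j (indicator A) x)"
      unfolding f_def using finJ disj by (intro sum.UNION_disjoint[symmetric]) simp_all
    also have "\<dots> \<le> 1"
      using x finJ by (intro sum_first_passage_le_1) auto
    finally show ?thesis .
  qed
  \<comment> \<open>pigeonhole: the stationary weights of the \<open>k\<close> windows add up to at most \<open>1\<close>\<close>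
  have "\<exists>i<k. (\<Sum>x\<in>S. pmf p x * f i x) \<le> 1 / real k"
  proof (rule ccontr)
    assume "\<not> ?thesis"
    then have "(\<Sum>i<k. 1 / real k) < (\<Sum>i<k. \<Sum>x\<in>S. pmf p x * f i x)"
      using k by (intro sum_strict_mono) (auto simp: not_le)
    also have "\<dots> = (\<Sum>x\<in>S. pmf p x * (\<Sum>i<k. f i x))"
      by (subst sum.swap) (simp add: sum_distrib_left)
    also have "\<dots> \<le> (\<Sum>x\<in>S. pmf p x * 1)"
      using sum_f by (intro sum_mono mult_left_mono) auto
    finally show False using k by (simp add: sum_p)
  qed
  then obtain i where i: "i < k" "(\<Sum>x\<in>S. pmf p x * f i x) \<le> 1 / real k" by blast
  have ti: "real (t i) \<le> mean - b"
  proof -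
    have "real i * real w \<le> real k * (2 * b + 1)"
      using i(1) w(2) b by (intro mult_mono) auto
    then show ?thesis using n by (simp add: t_def algebra_simps)
  qed
  have dev: "{\<omega> \<in> space M. \<bar>T \<omega> - mean\<bar> \<ge> b} \<in> events"
    using T_measurable by measurable
  \<comment> \<open>\<open>H j\<close>: the first visit to \<open>A\<close> at or after time \<open>t i\<close> takes place at time \<open>t i + j\<close>; when \<open>T \<ge> t i\<close>, this
    visit is the first one altogether\<close>
  define H where "H j = {\<omega> \<in> space M. (\<forall>i'<j. X (t i + i') \<omega> \<notin> A) \<and> X (t i + j) \<omega> \<in> A}" for j
  have H: "H j \<in> events" for j
  proof -
    have "{\<omega> \<in> space M. (\<lambda>z. (\<forall>i'<j. z (t i + i') \<notin> A) \<and> z (t i + j) \<in> A) (\<lambda>i. X i \<omega>)} \<in> events"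
      by (rule history_event[of "t i + j"]) auto
    then show ?thesis by (simp add: H_def)
  qed
  have "1 - (sd / b)\<^sup>2 \<le> prob (space M - {\<omega> \<in> space M. \<bar>T \<omega> - mean\<bar> \<ge> b})"
    using chebyshev[OF b] dev by (simp add: prob_compl)
  also have "\<dots> \<le> prob (\<Union>j\<in>J i. H j)"
  proof (rule finite_measure_mono)
    show "space M - {\<omega> \<in> space M. \<bar>T \<omega> - mean\<bar> \<ge> b} \<subseteq> (\<Union>j\<in>J i. H j)"
    proof
      fix \<omega> assume "\<omega> \<in> space M - {\<omega> \<in> space M. \<bar>T \<omega> - mean\<bar> \<ge> b}"
      then have w': "\<omega> \<in> space M" "\<bar>T \<omega> - mean\<bar> < b" by auto
      then have pos: "real (t i) < T \<omega>" using ti by linarith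
      show "\<omega> \<in> (\<Union>j\<in>J i. H j)"
      proof (cases rule: T_cases[of \<omega>])
        case never
        then show ?thesis using pos by simp
      next
        case (hit s)
        then have "t i < s" using pos by simp
        then have "s - t i \<in> J i" "\<omega> \<in> H (s - t i)"
          using hit w' by (auto simp: J_def H_def)
        then show ?thesis by blast
      qed
    qed
  qed (use finJ H in \<open>auto intro!: sets.finite_UN\<close>)
  also have "\<dots> \<le> (\<Sum>j\<in>J i. prob (H j))"
    using finJ H by (intro measure_UNION_le) auto
  also have "\<dots> = (\<Sum>x\<in>S. law (t i) x * f i x)"
    unfolding H_def prob_avoid f_def sum_distrib_left by (rule sum.swap)
  finally have "1 - (sd / b)\<^sup>2 - 1 / real k \<le> (\<Sum>x\<in>S. (law (t i) x - pmf p x) * f i x)"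
    using i(2) by (simp add: left_diff_distrib sum_subtractf)
  also have "\<dots> \<le> tv (t i)"
    using f01 by (rule tv_ge_function_aux)
  also have "\<dots> \<le> tv n"
    by (rule tv_antimono) (simp add: t_def)
  finally show ?thesis .
qed

end

section \<open>The spectral gap is bounded\<close>

text \<open>
  The restriction is substochastic: compare both sides of the eigenvalue equation at a point where the
  eigenvector has its largest modulus.
\<close>

lemma abs_eigenvalue_restrict_kernel_le_1:
  assumes "finite B" and "eigenvalue (restrict_kernel K B) r"
  shows "\<bar>r\<bar> \<le> 1"
proof -
  obtain v x where x: "x \<in> B" "v x \<noteq> 0"
    and v: "\<And>x. x \<in> B \<Longrightarrow> (\<Sum>y\<in>B. pmf (K x) y * v y) = r * v x"
    using assms by (auto simp: eigenvalue_restrict_kernel)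
  define m where "m = Max ((\<lambda>x. \<bar>v x\<bar>) ` B)"
  have le_m: "\<bar>v y\<bar> \<le> m" if "y \<in> B" for y
    using assms(1) that by (simp add: m_def)
  obtain z where z: "z \<in> B" "\<bar>v z\<bar> = m"
  proof -
    have "m \<in> (\<lambda>x. \<bar>v x\<bar>) ` B"
      unfolding m_def using assms(1) x(1) by (intro Max_in) auto
    then show thesis by (auto intro: that)
  qed
  have "m > 0"
    using le_m[OF x(1)] x(2) by simp
  have "\<bar>r\<bar> * m = \<bar>\<Sum>y\<in>B. pmf (K z) y * v y\<bar>"
    using v[OF z(1)] z(2) by (simp add: abs_mult)
  also have "\<dots> \<le> (\<Sum>y\<in>B. pmf (K z) y * m)"
    using le_m by (intro order_trans[OF sum_abs] sum_mono) (auto simp: abs_mult intro!: mult_left_mono)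
  also have "\<dots> = measure (measure_pmf (K z)) B * m"
    using assms(1) by (simp add: measure_measure_pmf_finite sum_distrib_right)
  also have "\<dots> \<le> 1 * m"
    using \<open>m > 0\<close> by (intro mult_right_mono measure_pmf.prob_le_1) auto
  finally show ?thesis using \<open>m > 0\<close> by simp
qed

text \<open>
  A nonempty spectrum is a finite subset of \<open>[-1, 1]\<close>. For an empty spectrum \<open>largest_eigenvalue\<close> is
  \<open>Max {}\<close>, whatever \<open>K\<close> and \<open>B\<close> are, which accounts for the second entry of the maximum below.
\<close>

lemma spectral_gap_bounded: "\<exists>C>0. \<forall>K (B :: 'a set). finite B \<longrightarrow> 1 - largest_eigenvalue K B \<le> C"
proof (intro exI[of _ "max 2 (1 - Max {})"] conjI allI impI)
  fix K :: "'a \<Rightarrow> 'a pmf" and B :: "'a set"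
  assume B: "finite B"
  have "finite (spectrum (restrict_kernel K B))"
    by (rule card_finite_spectrum(1)[of _ "card B"]) (simp add: restrict_kernel_def)
  then show "1 - largest_eigenvalue K B \<le> max 2 (1 - Max {})"
  proof (cases "spectrum (restrict_kernel K B) = {}")
    case False
    then have "eigenvalue (restrict_kernel K B) (largest_eigenvalue K B)"
      using Max_in[OF \<open>finite (spectrum _)\<close>] by (simp add: largest_eigenvalue_def spectrum_def)
    from abs_eigenvalue_restrict_kernel_le_1[OF B this] show ?thesis by simp
  qed (simp add: largest_eigenvalue_def)
qed simp

section \<open>From bounds at fixed times to cutoff\<close>

text \<open>
  Cutoff is a consequence of the two non-asymptotic bounds \<open>tv_upper\<close> and \<open>tv_lower\<close> for a sequence of
  chains, which the assumptions of this locale restate. Rounding to integer times is absorbed in the \<open>+ 1\<close> of the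
  upper bound and in the summand \<open>k\<close> of the lower one.
\<close>

locale mean_sd_bounds =
  fixes d :: "nat \<Rightarrow> nat \<Rightarrow> real" and E \<sigma> :: "nat \<Rightarrow> real"
  assumes d_nonneg: "0 \<le> d N n" and d_le_1: "d N n \<le> 1"
    and upper: "b > 0 \<Longrightarrow> E N + b < real n + 1 \<Longrightarrow> d N n \<le> (\<sigma> N / b)\<^sup>2"
    and lower: "b > 0 \<Longrightarrow> k > 0 \<Longrightarrow> real n + (2 * real k + 1) * b + real k \<le> E N \<Longrightarrow>
      1 - (\<sigma> N / b)\<^sup>2 - 1 / real k \<le> d N n"
    and small: "\<sigma> \<in> o(E)"
    and E_at_top: "filterlim E at_top sequentially"
begin

lemma eventually_E_ge: "\<forall>\<^sub>F N in sequentially. c \<le> E N"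
  using E_at_top by (simp add: filterlim_at_top)

lemma ratio_tendsto: "(\<lambda>N. (\<sigma> N / (c * E N))\<^sup>2) \<longlonglongrightarrow> 0"
proof -
  have "(\<lambda>N. (1 / c * (\<sigma> N / E N))\<^sup>2) \<longlonglongrightarrow> (1 / c * 0)\<^sup>2"
    by (intro tendsto_intros smalloD_tendsto small)
  then show ?thesis by simp
qed

lemma floor_plus_one: "x < real (nat \<lfloor>x\<rfloor>) + 1"
  by linarith

lemma cutoff_at_mean: "cutoff d E"
  unfolding cutoff_def
proof (intro conjI allI impI)
  fix c :: real assume c: "c > 1"
  have "\<forall>\<^sub>F N in sequentially. d N (nat \<lfloor>c * E N\<rfloor>) \<le> (\<sigma> N / ((c - 1) * E N))\<^sup>2"
    using eventually_E_ge[of 1]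
  proof eventually_elim
    case (elim N)
    show ?case
      using c elim floor_plus_one[of "c * E N"] by (intro upper) (auto simp: algebra_simps)
  qed
  then show "(\<lambda>N. d N (nat \<lfloor>c * E N\<rfloor>)) \<longlonglongrightarrow> 0"
    using d_nonneg by (intro tendsto_sandwich[OF _ _ tendsto_const ratio_tendsto]) auto
next
  fix c :: real assume c: "0 < c \<and> c < 1"
  show "(\<lambda>N. d N (nat \<lfloor>c * E N\<rfloor>)) \<longlonglongrightarrow> 1"
  proof (rule tendstoI)
    fix e :: real assume e: "e > 0"
    obtain k where k: "k > 0" "1 / real k < e / 2"
      using e real_arch_inverse[of "e / 2"] by (auto simp: inverse_eq_divide)
    \<comment> \<open>half of the gap \<open>(1 - c) E N\<close> is for the \<open>k\<close> windows of width about \<open>2 \<beta> E N\<close>, half for the rounding\<close>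
    define \<beta> where "\<beta> = (1 - c) / (2 * (2 * real k + 1))"
    have "h * (x / (2 * h)) = x / 2" if "h > 0" for h x :: real
      using that by simp
    from this[of "2 * real k + 1" "1 - c"]
    have \<beta>: "\<beta> > 0" "(2 * real k + 1) * \<beta> = (1 - c) / 2"
      using c by (simp_all add: \<beta>_def)
    have "\<forall>\<^sub>F N in sequentially. (\<sigma> N / (\<beta> * E N))\<^sup>2 < e / 2"
      by (intro order_tendstoD(2)[OF ratio_tendsto]) (use e in simp)
    with eventually_E_ge[of 1] eventually_E_ge[of "2 * real k / (1 - c)"]
    show "\<forall>\<^sub>F N in sequentially. dist (d N (nat \<lfloor>c * E N\<rfloor>)) 1 < e"
    proof eventually_elim
      case (elim N)
      have "real (nat \<lfloor>c * E N\<rfloor>) \<le> c * E N"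
        using c elim by (intro of_nat_floor) auto
      moreover have "(2 * real k + 1) * (\<beta> * E N) = (1 - c) / 2 * E N"
        by (simp add: \<beta>(2) flip: mult.assoc)
      moreover have "real k \<le> (1 - c) / 2 * E N"
        using c elim(2) by (simp add: field_simps)
      moreover have "c * E N + (1 - c) / 2 * E N + (1 - c) / 2 * E N = E N"
        by (simp add: field_simps)
      ultimately have "real (nat \<lfloor>c * E N\<rfloor>) + (2 * real k + 1) * (\<beta> * E N) + real k \<le> E N"
        by linarith
      then have "1 - (\<sigma> N / (\<beta> * E N))\<^sup>2 - 1 / real k \<le> d N (nat \<lfloor>c * E N\<rfloor>)"
        by (rule lower[rotated 2]) (use \<beta>(1) k(1) elim(1) in auto)
      then show ?case
        using elim(3) k(2) d_le_1[of N "nat \<lfloor>c * E N\<rfloor>"] by (simp add: dist_real_def)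
    qed
  qed
qed

text \<open>
  The bounds are used with \<open>b\<close> a multiple of \<open>\<sigma> N\<close>, so Chebyshev costs a constant. The rounding error
  \<open>k\<close> of the lower bound must be covered by a multiple of \<open>\<sigma> N\<close> too, which is why \<open>\<sigma>\<close> has to stay away
  from zero.
\<close>

lemma cutoff_window_at_mean:
  assumes s: "s > 0" and ev_s: "\<forall>\<^sub>F N in sequentially. s \<le> \<sigma> N"
  shows "cutoff_window d E \<sigma>"
  unfolding cutoff_window_def
proof (intro conjI small)
  show "((\<lambda>\<gamma>. limsup (\<lambda>N. ereal (d N (nat \<lfloor>E N + \<gamma> * \<sigma> N\<rfloor>)))) \<longlongrightarrow> 0) at_top"
  proof (rule tendsto_sandwich)
    show "\<forall>\<^sub>F \<gamma> in at_top. 0 \<le> limsup (\<lambda>N. ereal (d N (nat \<lfloor>E N + \<gamma> * \<sigma> N\<rfloor>)))"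
      by (intro always_eventually allI le_Limsup) (auto simp: d_nonneg)
    show "\<forall>\<^sub>F \<gamma> in at_top. limsup (\<lambda>N. ereal (d N (nat \<lfloor>E N + \<gamma> * \<sigma> N\<rfloor>))) \<le> ereal ((1 / \<gamma>)\<^sup>2)"
      using eventually_gt_at_top[of 0]
    proof eventually_elim
      case (elim \<gamma>)
      show ?case
      proof (rule Limsup_bounded)
        show "\<forall>\<^sub>F N in sequentially. ereal (d N (nat \<lfloor>E N + \<gamma> * \<sigma> N\<rfloor>)) \<le> ereal ((1 / \<gamma>)\<^sup>2)"
          using ev_s
        proof eventually_elim
          case (elim N)
          have "d N (nat \<lfloor>E N + \<gamma> * \<sigma> N\<rfloor>) \<le> (\<sigma> N / (\<gamma> * \<sigma> N))\<^sup>2"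
            using \<open>\<gamma> > 0\<close> s elim floor_plus_one by (intro upper) auto
          also have "\<sigma> N / (\<gamma> * \<sigma> N) = 1 / \<gamma>"
            using s elim by simp
          finally show ?case by simp
        qed
      qed
    qed
    have "((\<lambda>\<gamma>::real. (1 / \<gamma>)\<^sup>2) \<longlongrightarrow> 0\<^sup>2) at_top"
      by (intro tendsto_power tendsto_divide_0[OF tendsto_const] filterlim_at_top_imp_at_infinity filterlim_ident)
    then show "((\<lambda>\<gamma>::real. ereal ((1 / \<gamma>)\<^sup>2)) \<longlongrightarrow> 0) at_top"
      by (simp add: zero_ereal_def)
  qed simp
next
  show "((\<lambda>\<gamma>. liminf (\<lambda>N. ereal (d N (nat \<lfloor>E N - \<gamma> * \<sigma> N\<rfloor>)))) \<longlongrightarrow> 1) at_top"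
  proof (rule order_tendstoI)
    fix a :: ereal assume "1 < a"
    moreover have "liminf (\<lambda>N. ereal (d N (nat \<lfloor>E N - \<gamma> * \<sigma> N\<rfloor>))) \<le> 1" for \<gamma>
      by (rule Liminf_le) (auto simp: d_le_1)
    ultimately show "\<forall>\<^sub>F \<gamma> in at_top. liminf (\<lambda>N. ereal (d N (nat \<lfloor>E N - \<gamma> * \<sigma> N\<rfloor>))) < a"
      by (intro always_eventually allI) (rule le_less_trans)
  next
    fix a :: ereal assume "a < 1"
    then obtain a' where a': "a < ereal a'" "a' < 1"
      using ereal_dense2[of a 1] by auto
    obtain k where k: "k > 0" "1 / real k < (1 - a') / 2"
      using a'(2) real_arch_inverse[of "(1 - a') / 2"] by (auto simp: inverse_eq_divide)
    \<comment> \<open>taking \<open>b = k \<sigma> N\<close> makes the Chebyshev term \<open>1 / k\<^sup>2\<close>; then \<open>g \<sigma> N\<close> is the room that \<open>lower\<close> asks for\<close>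
    define g where "g = (2 * real k + 1) * real k + real k / s"
    have "\<forall>\<^sub>F \<gamma> in at_top. \<gamma> \<ge> g \<and> \<gamma> > 0"
      by (intro eventually_conj eventually_ge_at_top eventually_gt_at_top)
    then show "\<forall>\<^sub>F \<gamma> in at_top. a < liminf (\<lambda>N. ereal (d N (nat \<lfloor>E N - \<gamma> * \<sigma> N\<rfloor>)))"
    proof eventually_elim
      case (elim \<gamma>)
      have "\<forall>\<^sub>F N in sequentially. norm (\<sigma> N) \<le> 1 / \<gamma> * norm (E N)"
        using elim by (intro landau_o.smallD[OF small]) auto
      with ev_s eventually_E_ge[of 0]
      have "\<forall>\<^sub>F N in sequentially. ereal a' \<le> ereal (d N (nat \<lfloor>E N - \<gamma> * \<sigma> N\<rfloor>))"
      proof eventually_elim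
        case N: (elim N)
        have "\<gamma> * \<sigma> N \<le> E N"
          using N elim s by (simp add: field_simps)
        then have "real (nat \<lfloor>E N - \<gamma> * \<sigma> N\<rfloor>) \<le> E N - \<gamma> * \<sigma> N"
          by (intro of_nat_floor) auto
        moreover have "g * \<sigma> N \<le> \<gamma> * \<sigma> N"
          using elim N s by (intro mult_right_mono) auto
        moreover have "real k \<le> real k / s * \<sigma> N"
          using N s k(1) by (simp add: field_simps)
        ultimately have "1 - (\<sigma> N / (real k * \<sigma> N))\<^sup>2 - 1 / real k \<le> d N (nat \<lfloor>E N - \<gamma> * \<sigma> N\<rfloor>)"
          using k(1) N s by (intro lower) (auto simp: g_def algebra_simps)
        moreover have "(\<sigma> N / (real k * \<sigma> N))\<^sup>2 \<le> 1 / real k"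
        proof -
          have "(\<sigma> N / (real k * \<sigma> N))\<^sup>2 = (1 / real k)\<^sup>2"
            using N s by simp
          also have "\<dots> \<le> 1 / real k"
            using k(1) by (simp add: power2_eq_square field_simps)
          finally show ?thesis .
        qed
        ultimately show ?case using k(2) by simp
      qed
      then have "ereal a' \<le> liminf (\<lambda>N. ereal (d N (nat \<lfloor>E N - \<gamma> * \<sigma> N\<rfloor>)))"
        by (rule Liminf_bounded)
      with a'(1) show ?case by (rule less_le_trans)
    qed
  qed
qed

end

section \<open>Cutoff at the mean hitting time\<close>

theorem proposition1p3:
  fixes M :: "nat \<Rightarrow> 'w measure"
    and S A :: "nat \<Rightarrow> 'a set"
    and K :: "nat \<Rightarrow> 'a \<Rightarrow> 'a pmf"
    and X :: "nat \<Rightarrow> nat \<Rightarrow> 'w \<Rightarrow> 'a"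
    and p :: "nat \<Rightarrow> 'a pmf"
    and E \<sigma> l :: "nat \<Rightarrow> real"
    and d :: "nat \<Rightarrow> nat \<Rightarrow> real"
  defines "E \<equiv> \<lambda>N. mean_hit (M N) (X N) (A N)"
    and "\<sigma> \<equiv> \<lambda>N. sd_hit (M N) (X N) (A N)"
    and "l \<equiv> \<lambda>N. largest_eigenvalue (K N) (S N - A N)"
    and "d \<equiv> \<lambda>N. tv_to (M N) (X N) (p N)"
  assumes "\<And>N. finite (S N)"
    and "\<And>N. markov_chain (M N) (S N) (K N) (X N)"
    and "\<And>N. irreducible_on (S N) (K N)"
    and "\<And>N. aperiodic_on (S N) (K N)"
    and "\<And>N. stationary_on (S N) (K N) (p N)"
    and "\<And>N. A N \<subseteq> S N"
    and "\<And>N. A N \<noteq> {}"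
    and "\<And>N. tv_halting_set (M N) (X N) (p N) (A N)"
    and "\<sigma> \<in> o(E)"
  shows "(filterlim (\<lambda>N. (1 - l N) * E N) at_top sequentially \<longrightarrow> cutoff d E) \<and>
    (filterlim (\<lambda>N. (1 - l N) * E N) at_top sequentially \<and>
       liminf (\<lambda>N. ereal ((1 - l N) * \<sigma> N)) > 0 \<longrightarrow> cutoff_window d E \<sigma>)"
proof -
  have hc: "halting_chain (M N) (S N) (K N) (X N) (p N) (A N)" for N
    using assms by (auto simp: halting_chain_def halting_chain_axioms_def finite_chain_def
        finite_chain_axioms_def markov_chain_def)
  obtain C where C: "C > 0" "\<And>N. 1 - l N \<le> C"
  proof -
    obtain C where "C > 0"
      and gap: "\<And>K (B :: 'a set). finite B \<Longrightarrow> 1 - largest_eigenvalue K B \<le> C"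
      using spectral_gap_bounded[where 'a = 'a] by blast
    moreover have "finite (S N - A N)" for N
      using assms by auto
    ultimately show thesis
      by (intro that[of C]) (auto simp: l_def)
  qed
  have E_nonneg: "0 \<le> E N" and \<sigma>_nonneg: "0 \<le> \<sigma> N" for N
    unfolding E_def \<sigma>_def by (rule halting_chain.mean_nonneg[OF hc] halting_chain.sd_nonneg[OF hc])+
  have bounds: "mean_sd_bounds d E \<sigma>" if gap: "filterlim (\<lambda>N. (1 - l N) * E N) at_top sequentially"
  proof
    show "0 \<le> d N n" "d N n \<le> 1" for N n
      unfolding d_def by (rule halting_chain.tv_nonneg[OF hc] halting_chain.tv_le_1[OF hc])+
    show "d N n \<le> (\<sigma> N / b)\<^sup>2" if "b > 0" "E N + b < real n + 1" for N n b
      using halting_chain.tv_upper[OF hc] that unfolding d_def E_def \<sigma>_def .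
    show "1 - (\<sigma> N / b)\<^sup>2 - 1 / real k \<le> d N n"
      if "b > 0" "k > 0" "real n + (2 * real k + 1) * b + real k \<le> E N" for N n k b
      using halting_chain.tv_lower[OF hc] that unfolding d_def E_def \<sigma>_def .
    show "\<sigma> \<in> o(E)" by fact
    have "filterlim (\<lambda>N. C * E N) at_top sequentially"
      using gap by (rule filterlim_at_top_mono)
        (use C E_nonneg in \<open>auto intro!: always_eventually mult_right_mono\<close>)
    from filterlim_tendsto_pos_mult_at_top[OF tendsto_const[of "1 / C"] _ this]
    have "filterlim (\<lambda>N. 1 / C * (C * E N)) at_top sequentially"
      using C(1) by simp
    moreover have "(\<lambda>N. 1 / C * (C * E N)) = E"
      using C(1) by auto
    ultimately show "filterlim E at_top sequentially"
      by (simp only:)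
  qed
  have \<sigma>_bound: "\<exists>s>0. \<forall>\<^sub>F N in sequentially. s \<le> \<sigma> N"
    if pos: "liminf (\<lambda>N. ereal ((1 - l N) * \<sigma> N)) > 0"
  proof -
    obtain y where y: "0 < ereal y" "ereal y < liminf (\<lambda>N. ereal ((1 - l N) * \<sigma> N))"
      using ereal_dense2[OF pos] by auto
    have "\<forall>\<^sub>F N in sequentially. y / C \<le> \<sigma> N"
      using less_LiminfD[OF y(2)]
    proof eventually_elim
      case (elim N)
      have "y \<le> C * \<sigma> N"
        using elim mult_right_mono[OF C(2)[of N] \<sigma>_nonneg[of N]] by simp
      then show ?case using C(1) by (simp add: field_simps)
    qed
    with y(1) C(1) show ?thesis by (intro exI[of _ "y / C"]) auto
  qed
  show ?thesis
    using bounds \<sigma>_bound mean_sd_bounds.cutoff_at_mean mean_sd_bounds.cutoff_window_at_mean by blast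
qed

end
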